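(* Let $\check R$ be the $9\times9$ matrix $$\check R=\begin{bmatrix} 1&0&0&0&0&0&0&0&0\\ 0&0&0&1&0&0&0&0&0\\ 0&0&0&0&0&0&-1&0&0\\ 0&-1&0&0&0&0&0&0&0\\ 0&0&0&0&1&0&0&0&0\\ 0&0&0&0&0&0&0&1&0\\ 0&0&1&0&0&0&0&0&0\\ 0&0&0&0&0&-1&0&0&0\\ 0&0&0&0&0&0&0&0&1 \end{bmatrix}.$$ Each of the following two matrix functions of $u\in\mathbb C$ is of the form $f(u)\,I\otimes I+g(u)\check R+h(u)\check R^{-1}$ for some functions $f,g,h$, and satisfies the braiding Yang--Baxter equation $$\check R_{12}(u)\check R_{23}(u+v)\check R_{12}(v)=\check R_{23}(v)\check R_{12}(u+v)\check R_{23}(u)$$ for all $u,v\in\mathbb C$: (i) $\check R(u)=\mathrm{diag}(e^u,1,1,1,e^u,1,1,1,e^u)$; (ii) $$\check R(u)=\begin{bmatrix} 1+u&0&0&0&0&0&0&0&0\\ 0&1&0&iu&0&0&0&0&0\\ 0&0&1&0&0&0&-iu&0&0\\ 0&-iu&0&1&0&0&0&0&0\\ 0&0&0&0&1+u&0&0&0&0\\ 0&0&0&0&0&1&0&iu&0\\ 0&0&iu&0&0&0&1&0&0\\ 0&0&0&0&0&-iu&0&1&0\\ 0&0&0&0&0&0&0&0&1+u \end{bmatrix}.$$ Moreover, in neither case does $\check R(u)$ converge to $\check R$ as $u\to-\infty$ along the real axis.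
   Context: Matrices of size $9\times9$ are operators on $V\otimes V$ with $V=\mathbb C^3$, in the basis $e_i\otimes e_j$ ($1\le i,j\le3$) ordered lexicographically; $I$ is the identity on $V$, and $i$ inside matrix entries is the imaginary unit. For an operator $M$ on $V\otimes V$, $M_{12}=M\otimes I$ and $M_{23}=I\otimes M$ on $V\otimes V\otimes V$. *)

theory Defs
  imports "HOL-Analysis.Analysis"
begin

text \<open>
  An operator on \<open>V \<otimes> V\<close>, \<open>V = \<complex>\<^sup>3\<close>, is a matrix whose rows and columns are indexed by
  \<open>3 \<times> 3\<close>, the index \<open>(i, j)\<close> standing for the basis vector \<open>e\<^sub>i \<otimes> e\<^sub>j\<close>; an operator on
  \<open>V \<otimes> V \<otimes> V\<close> is indexed by \<open>3 \<times> 3 \<times> 3\<close>.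
\<close>

type_synonym op2 = "complex ^ (3 \<times> 3) ^ (3 \<times> 3)"
type_synonym op3 = "complex ^ (3 \<times> 3 \<times> 3) ^ (3 \<times> 3 \<times> 3)"

text \<open>The numeral type \<open>3\<close> is arithmetic modulo 3, so the third basis index is \<open>3 = 0\<close>;
  positions are therefore given explicitly.\<close>

definition idx :: "3 \<Rightarrow> nat"
  where "idx i = (if i = 1 then 0 else if i = 2 then 1 else 2)"

definition lex_pos :: "3 \<times> 3 \<Rightarrow> nat"
  where "lex_pos p = 3 * idx (fst p) + idx (snd p)"

definition mat9 :: "complex list list \<Rightarrow> op2"
  where "mat9 xss = (\<chi> p q. xss ! lex_pos p ! lex_pos q)"

definition diag9 :: "complex list \<Rightarrow> op2"
  where "diag9 ds = (\<chi> p q. if p = q then ds ! lex_pos p else 0)"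

definition kron :: "complex ^ 'n ^ 'm \<Rightarrow> complex ^ 'q ^ 'p \<Rightarrow> complex ^ ('n \<times> 'q) ^ ('m \<times> 'p)"
  where "kron A B = (\<chi> r c. A $ fst r $ fst c * B $ snd r $ snd c)"

definition scale_mat :: "complex \<Rightarrow> complex ^ 'n ^ 'm \<Rightarrow> complex ^ 'n ^ 'm"
  where "scale_mat c A = (\<chi> r. c *s A $ r)"

text \<open>\<open>kron M (mat 1)\<close> is indexed by \<open>(3 \<times> 3) \<times> 3\<close> and has to be reindexed
  along the associativity isomorphism.\<close>

definition op12 :: "op2 \<Rightarrow> op3"
  where "op12 M = (\<chi> r c. kron M (mat 1 :: complex ^ 3 ^ 3)
           $ ((fst r, fst (snd r)), snd (snd r)) $ ((fst c, fst (snd c)), snd (snd c)))"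

definition op23 :: "op2 \<Rightarrow> op3"
  where "op23 M = kron (mat 1 :: complex ^ 3 ^ 3) M"

definition braiding_YBE :: "(complex \<Rightarrow> op2) \<Rightarrow> bool"
  where "braiding_YBE R \<longleftrightarrow>
    (\<forall>u v. op12 (R u) ** op23 (R (u + v)) ** op12 (R v)
         = op23 (R v) ** op12 (R (u + v)) ** op23 (R u))"

definition baxter_form :: "op2 \<Rightarrow> (complex \<Rightarrow> op2) \<Rightarrow> bool"
  where "baxter_form B R \<longleftrightarrow>
    (\<exists>f g h :: complex \<Rightarrow> complex. \<forall>u.
       R u = scale_mat (f u) (kron (mat 1 :: complex ^ 3 ^ 3) (mat 1 :: complex ^ 3 ^ 3))
           + scale_mat (g u) B + scale_mat (h u) (matrix_inv B))"

definition Rcheck :: op2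
  where "Rcheck = mat9
   [[1,  0,  0,  0,  0,  0,  0,  0,  0],
    [0,  0,  0,  1,  0,  0,  0,  0,  0],
    [0,  0,  0,  0,  0,  0, -1,  0,  0],
    [0, -1,  0,  0,  0,  0,  0,  0,  0],
    [0,  0,  0,  0,  1,  0,  0,  0,  0],
    [0,  0,  0,  0,  0,  0,  0,  1,  0],
    [0,  0,  1,  0,  0,  0,  0,  0,  0],
    [0,  0,  0,  0,  0, -1,  0,  0,  0],
    [0,  0,  0,  0,  0,  0,  0,  0,  1]]"

definition Rcheck_i :: "complex \<Rightarrow> op2"
  where "Rcheck_i u = diag9 [exp u, 1, 1, 1, exp u, 1, 1, 1, exp u]"

definition Rcheck_ii :: "complex \<Rightarrow> op2"
  where "Rcheck_ii u = mat9
   [[1 + u, 0,         0,         0,        0,     0,         0,          0,        0],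
    [0,     1,         0,         \<i> * u,    0,     0,         0,          0,        0],
    [0,     0,         1,         0,        0,     0,         - (\<i> * u), 0,        0],
    [0,     - (\<i> * u), 0,        1,        0,     0,         0,          0,        0],
    [0,     0,         0,         0,        1 + u, 0,         0,          0,        0],
    [0,     0,         0,         0,        0,     1,         0,          \<i> * u,    0],
    [0,     0,         \<i> * u,     0,        0,     0,         1,          0,        0],
    [0,     0,         0,         0,        0,     - (\<i> * u), 0,         1,        0],
    [0,     0,         0,         0,        0,     0,         0,          0,        1 + u]]"

lemma sum_UNIV_33:
  fixes f :: "3 \<times> 3 \<Rightarrow> 'a::comm_monoid_add"
  shows "sum f UNIV = (\<Sum>i\<in>UNIV. \<Sum>j\<in>UNIV. f (i, j))"
  by (simp add: sum.cartesian_product UNIV_Times_UNIV[symmetric] del: UNIV_Times_UNIV)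

lemma Rcheck_orthogonal: "Rcheck ** transpose Rcheck = mat 1"
  by (simp add: vec_eq_iff forall_3 matrix_matrix_mult_def transpose_def Rcheck_def mat9_def
      mat_def lex_pos_def idx_def split_paired_All sum_UNIV_33 sum_3)

text \<open>Hence \<open>matrix_inv Rcheck\<close>, which is an arbitrary matrix for singular arguments,
  is the genuine inverse.\<close>

lemma invertible_Rcheck: "invertible Rcheck"
  using Rcheck_orthogonal by (auto simp: invertible_right_inverse)

end

theory Submission
  imports Defs
begin

text \<open>
  All matrices involved are combinations of monomial matrices, one nonzero entry per row, whose
  products are computed by composing maps and multiplying weights. The given matrix is a flip
  \<open>e\<^sub>i \<otimes> e\<^sub>j \<mapsto> \<plusminus> e\<^sub>j \<otimes> e\<^sub>i\<close> whose sign depends only on the cyclic order of \<open>i, j\<close> modulo 3.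
  It belongs to the family \<open>twisted_flip c\<close>, with weights \<open>1\<close> on the diagonal pairs and \<open>c\<close>, \<open>-c\<close> on the
  two orientations of the remaining pairs: it is the member \<open>c = 1\<close>, and its inverse is the member \<open>c = -1\<close>.
  As the family is affine in \<open>c\<close>, every member is a combination of these two, and therefore
  \<open>1 + \<phi>(u) twisted_flip c\<close> has Baxter form for every \<open>\<phi>\<close> and \<open>c\<close>. Both solutions have
  this shape: (i) with \<open>c = 0\<close> and \<open>\<phi>(u) = exp u - 1\<close>, (ii) with \<open>c = \<i>\<close> and \<open>\<phi>(u) = u\<close>.

  The Yang--Baxter equation holds in case (i) because the matrices are diagonal and form a
  one-parameter group, so that both sides equal \<open>R\<^sub>1\<^sub>2(u+v) R\<^sub>2\<^sub>3(u+v)\<close>. Case (ii) is Yang's rational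
  solution: a flip with arbitrary weights satisfies the braid relation, \<open>twisted_flip c\<close> has square 1
  exactly when \<open>c\<^sup>2 = -1\<close>, and \<open>1 + u Q\<close> solves the equation for every involution \<open>Q\<close>
  satisfying the braid relation. Neither family converges to the given matrix, since each has
  a constant entry that differs from the corresponding entry of that matrix.
\<close>

section \<open>Monomial matrices\<close>

definition monomial_mat :: "('n \<Rightarrow> complex) \<Rightarrow> ('n \<Rightarrow> 'n) \<Rightarrow> complex ^ 'n ^ 'n"
  where "monomial_mat w f = (\<chi> r c. if c = f r then w r else 0)"

lemma monomial_mat_mult:
  "monomial_mat w f ** monomial_mat w' f' = monomial_mat (\<lambda>r. w r * w' (f r)) (\<lambda>r. f' (f r))"
proof -
  have "(\<Sum>k\<in>UNIV. (if k = f r then w r else 0) * (if c = f' k then w' k else 0)) =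
      (if c = f' (f r) then w r * w' (f r) else 0)" for r c
  proof -
    have "(\<Sum>k\<in>UNIV. (if k = f r then w r else 0) * (if c = f' k then w' k else 0)) =
        (\<Sum>k\<in>UNIV. if k = f r then w r * (if c = f' k then w' k else 0) else 0)"
      by (rule sum.cong) auto
    then show ?thesis
      by simp
  qed
  then show ?thesis
    by (simp add: monomial_mat_def matrix_matrix_mult_def vec_eq_iff)
qed

lemma mat_1_monomial: "mat 1 = monomial_mat (\<lambda>_. 1) (\<lambda>r. r)"
  by (auto simp: monomial_mat_def mat_def vec_eq_iff)

lemma op12_monomial:
  "op12 (monomial_mat w f) =
     monomial_mat (\<lambda>(a, b, c). w (a, b)) (\<lambda>(a, b, c). (fst (f (a, b)), snd (f (a, b)), c))"
  by (auto simp: op12_def kron_def mat_def monomial_mat_def vec_eq_iff prod_eq_iff)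

lemma op23_monomial:
  "op23 (monomial_mat w f) = monomial_mat (\<lambda>(a, p). w p) (\<lambda>(a, p). (a, f p))"
  by (auto simp: op23_def kron_def mat_def monomial_mat_def vec_eq_iff prod_eq_iff)

lemma kron_mat_1: "kron (mat 1) (mat 1) = mat 1"
  by (auto simp: kron_def mat_def vec_eq_iff prod_eq_iff)

section \<open>Solutions of the braiding Yang--Baxter equation\<close>

text \<open>Diagonal matrices commute, so a one-parameter group of them collapses both sides.\<close>

lemma braiding_YBE_diagonal:
  assumes "\<And>u v p. w u p * w v p = w (u + v) p"
  shows "braiding_YBE (\<lambda>u. monomial_mat (w u) (\<lambda>p. p))"
proof -
  have collapse: "w u p * w (u + v) q * w v p = w (u + v) p * w (u + v) q"
    "w v q * w (u + v) p * w u q = w (u + v) p * w (u + v) q" for u v p q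
    by (simp_all only: assms[of u _ v, symmetric] mult_ac)
  show ?thesis
    by (simp add: braiding_YBE_def op12_monomial op23_monomial monomial_mat_mult collapse
        case_prod_unfold)
qed

text \<open>In both triple products a flip of the tensor factors meets each of the pairs \<open>(a, b)\<close>, \<open>(a, c)\<close>,
  \<open>(b, c)\<close> once, in opposite orders; hence the weights do not matter.\<close>

lemma weighted_flip_braid:
  fixes w :: "3 \<times> 3 \<Rightarrow> complex"
  defines "Q \<equiv> monomial_mat w prod.swap"
  shows "op12 Q ** op23 Q ** op12 Q = op23 Q ** op12 Q ** op23 Q"
  by (simp add: Q_def op12_monomial op23_monomial monomial_mat_mult case_prod_unfold mult_ac)

lemma op12_affine: "op12 (mat 1 + scale_mat c Q) = mat 1 + scale_mat c (op12 Q)"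
  by (auto simp: op12_def kron_def scale_mat_def mat_def vec_eq_iff prod_eq_iff algebra_simps)

lemma op23_affine: "op23 (mat 1 + scale_mat c Q) = mat 1 + scale_mat c (op23 Q)"
  by (auto simp: op23_def kron_def scale_mat_def mat_def vec_eq_iff prod_eq_iff algebra_simps)

lemma affine_triple_product:
  fixes X Y Z :: "complex ^ 'n::finite ^ 'n"
  shows "(mat 1 + scale_mat a X) ** (mat 1 + scale_mat b Y) ** (mat 1 + scale_mat c Z) =
    mat 1 + scale_mat a X + scale_mat b Y + scale_mat c Z
    + scale_mat (a * b) (X ** Y) + scale_mat (a * c) (X ** Z) + scale_mat (b * c) (Y ** Z)
    + scale_mat (a * b * c) (X ** Y ** Z)"
proof -
  have l: "scale_mat k A ** B = scale_mat k (A ** B)" for k and A B :: "complex ^ 'n ^ 'n"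
    by (simp add: scale_mat_def matrix_matrix_mult_def vec_eq_iff sum_distrib_left mult_ac)
  have r: "A ** scale_mat k B = scale_mat k (A ** B)" for k and A B :: "complex ^ 'n ^ 'n"
    by (simp add: scale_mat_def matrix_matrix_mult_def vec_eq_iff sum_distrib_left mult_ac)
  have d: "(A + B) ** C = A ** C + B ** C" for A B C :: "complex ^ 'n ^ 'n"
    by (simp add: matrix_matrix_mult_def vec_eq_iff sum.distrib algebra_simps)
  have s: "scale_mat k (A + B) = scale_mat k A + scale_mat k B"
    "scale_mat k (scale_mat m A) = scale_mat (k * m) A" for k m and A B :: "complex ^ 'n ^ 'n"
    by (simp_all add: scale_mat_def vec_eq_iff algebra_simps)
  show ?thesis
    by (simp add: matrix_add_ldistrib d l r s matrix_mul_assoc mult_ac add_ac)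
qed

text \<open>The triple products of \<open>X = Q\<^sub>1\<^sub>2\<close> and \<open>Y = Q\<^sub>2\<^sub>3\<close> differ by
  \<open>u v (X\<^sup>2 - Y\<^sup>2) + u v (u + v) (X Y X - Y X Y)\<close>: the involution property kills the first
  term, the braid relation the second.\<close>

lemma braiding_YBE_rational:
  assumes sq: "Q ** Q = mat 1"
    and Q: "Q = monomial_mat w prod.swap"
  shows "braiding_YBE (\<lambda>u. mat 1 + scale_mat u Q)"
proof -
  let ?X = "op12 Q" and ?Y = "op23 Q"
  have w: "w p * w (prod.swap p) = 1" for p
    using arg_cong[OF sq, of "\<lambda>M. M $ p $ p"]
    unfolding Q monomial_mat_mult by (simp add: monomial_mat_def mat_def)
  have X: "?X ** ?X = mat 1" and Y: "?Y ** ?Y = mat 1"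
    unfolding Q op12_monomial op23_monomial monomial_mat_mult mat_1_monomial
    using w[of "(a, b)" for a b] by (simp_all add: case_prod_unfold w)
  have braid: "?X ** ?Y ** ?X = ?Y ** ?X ** ?Y"
    unfolding Q by (rule weighted_flip_braid)
  show ?thesis
    unfolding braiding_YBE_def op12_affine op23_affine affine_triple_product X Y braid
    by (simp add: scale_mat_def vec_eq_iff algebra_simps)
qed

section \<open>The cyclic family of flips\<close>

text \<open>The numeral type \<open>3\<close> being the integers modulo 3, the condition \<open>j = i + 1\<close> singles out the pairs
  \<open>(1, 2)\<close>, \<open>(2, 3)\<close>, \<open>(3, 1)\<close>.\<close>

definition cyclic_weight :: "complex \<Rightarrow> 3 \<times> 3 \<Rightarrow> complex"
  where "cyclic_weight c = (\<lambda>(i, j). if i = j then 1 else if j = i + 1 then c else - c)"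

definition twisted_flip :: "complex \<Rightarrow> op2"
  where "twisted_flip c = monomial_mat (cyclic_weight c) prod.swap"

text \<open>Exchanging the two factors reverses the orientation of the pair, so the product of the
  weights on a nondiagonal pair is \<open>-c d\<close>.\<close>

lemma twisted_flip_mult:
  assumes "c * d = -1"
  shows "twisted_flip c ** twisted_flip d = mat 1"
proof -
  have "\<forall>i j. cyclic_weight c (i, j) * cyclic_weight d (j, i) = 1"
    using assms by (simp add: forall_3 cyclic_weight_def)
  then have "(\<lambda>p. cyclic_weight c p * cyclic_weight d (prod.swap p)) = (\<lambda>_. 1)"
    by auto
  then show ?thesis
    by (simp add: twisted_flip_def monomial_mat_mult mat_1_monomial)
qed

lemma twisted_flip_affine:
  "twisted_flip c = scale_mat ((1 + c) / 2) (twisted_flip 1)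
     + scale_mat ((1 - c) / 2) (twisted_flip (-1))"
  by (auto simp: twisted_flip_def monomial_mat_def cyclic_weight_def scale_mat_def vec_eq_iff
      field_simps)

lemma Rcheck_eq_twisted_flip: "Rcheck = twisted_flip 1"
  by (simp add: vec_eq_iff forall_3 Rcheck_def mat9_def lex_pos_def idx_def split_paired_All
      twisted_flip_def monomial_mat_def cyclic_weight_def)

lemma matrix_inv_Rcheck: "matrix_inv Rcheck = twisted_flip (-1)"
proof -
  have "twisted_flip 1 ** twisted_flip (-1) = mat 1"
    by (rule twisted_flip_mult) simp
  moreover have "matrix_inv Rcheck ** Rcheck = mat 1"
    using invertible_Rcheck unfolding invertible_def matrix_inv_def
    by (rule someI2_ex) simp
  ultimately show ?thesis
    by (metis Rcheck_eq_twisted_flip matrix_mul_assoc matrix_mul_lid matrix_mul_rid)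
qed

lemma baxter_form_twisted_flip:
  "baxter_form Rcheck (\<lambda>u. mat 1 + scale_mat (\<phi> u) (twisted_flip c))"
proof -
  have "mat 1 + scale_mat (\<phi> u) (twisted_flip c) =
      scale_mat 1 (mat 1)
      + scale_mat (\<phi> u * ((1 + c) / 2)) (twisted_flip 1)
      + scale_mat (\<phi> u * ((1 - c) / 2)) (twisted_flip (-1))" for u
    by (subst twisted_flip_affine) (simp add: scale_mat_def vec_eq_iff algebra_simps)
  then show ?thesis
    unfolding baxter_form_def kron_mat_1 matrix_inv_Rcheck
    unfolding Rcheck_eq_twisted_flip
    by (rule exI[of _ "\<lambda>_. 1",
          OF exI[of _ "\<lambda>u. \<phi> u * ((1 + c) / 2)",
          OF exI[of _ "\<lambda>u. \<phi> u * ((1 - c) / 2)", OF allI]]])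
qed

section \<open>The two solutions\<close>

lemma Rcheck_i_diagonal:
  "Rcheck_i u = monomial_mat (\<lambda>p. if fst p = snd p then exp u else 1) (\<lambda>p. p)"
  by (simp add: vec_eq_iff forall_3 Rcheck_i_def diag9_def lex_pos_def idx_def split_paired_All
      monomial_mat_def)

text \<open>The member \<open>c = 0\<close> of the family is the projection onto the span of the \<open>e\<^sub>i \<otimes> e\<^sub>i\<close>.\<close>

lemma Rcheck_i_twisted_flip: "Rcheck_i u = mat 1 + scale_mat (exp u - 1) (twisted_flip 0)"
  by (auto simp: Rcheck_i_diagonal vec_eq_iff scale_mat_def mat_def twisted_flip_def
      monomial_mat_def cyclic_weight_def)

lemma Rcheck_ii_twisted_flip: "Rcheck_ii u = mat 1 + scale_mat u (twisted_flip \<i>)"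
  by (simp add: vec_eq_iff forall_3 Rcheck_ii_def mat9_def lex_pos_def idx_def split_paired_All
      scale_mat_def mat_def twisted_flip_def monomial_mat_def cyclic_weight_def)

lemma not_tendsto_of_constant_entry:
  fixes L :: "complex ^ 'n ^ 'm"
  assumes "F \<noteq> bot" and "\<And>x. M x $ p $ q = k" and "L $ p $ q \<noteq> k"
  shows "\<not> (M \<longlongrightarrow> L) F"
proof
  assume "(M \<longlongrightarrow> L) F"
  then have "((\<lambda>x. M x $ p $ q) \<longlongrightarrow> L $ p $ q) F"
    by (intro tendsto_vec_nth)
  with assms show False
    by (simp add: tendsto_const_iff)
qed

theorem mainTheorem6:
  shows "(baxter_form Rcheck Rcheck_i \<and> braiding_YBE Rcheck_i)
    \<and> (baxter_form Rcheck Rcheck_ii \<and> braiding_YBE Rcheck_ii)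
    \<and> \<not> ((\<lambda>x::real. Rcheck_i (complex_of_real x)) \<longlongrightarrow> Rcheck) at_bot
    \<and> \<not> ((\<lambda>x::real. Rcheck_ii (complex_of_real x)) \<longlongrightarrow> Rcheck) at_bot"
proof (intro conjI)
  show "baxter_form Rcheck Rcheck_i"
    using baxter_form_twisted_flip[of "\<lambda>u. exp u - 1" 0]
    by (simp flip: Rcheck_i_twisted_flip)
  show "baxter_form Rcheck Rcheck_ii"
    using baxter_form_twisted_flip[of "\<lambda>u. u" \<i>]
    by (simp flip: Rcheck_ii_twisted_flip)
  show "braiding_YBE Rcheck_i"
    unfolding Rcheck_i_diagonal[abs_def]
    by (rule braiding_YBE_diagonal) (simp add: exp_add)
  show "braiding_YBE Rcheck_ii"
    unfolding Rcheck_ii_twisted_flip[abs_def]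
    by (rule braiding_YBE_rational[OF twisted_flip_mult twisted_flip_def]) simp
  show "\<not> ((\<lambda>x::real. Rcheck_i (complex_of_real x)) \<longlongrightarrow> Rcheck) at_bot"
    by (rule not_tendsto_of_constant_entry[where p = "(1, 2)" and q = "(2, 1)" and k = 0])
      (simp_all add: Rcheck_i_diagonal Rcheck_eq_twisted_flip twisted_flip_def monomial_mat_def
        cyclic_weight_def)
  show "\<not> ((\<lambda>x::real. Rcheck_ii (complex_of_real x)) \<longlongrightarrow> Rcheck) at_bot"
    by (rule not_tendsto_of_constant_entry[where p = "(1, 2)" and q = "(1, 2)" and k = 1])
      (simp_all add: Rcheck_ii_twisted_flip Rcheck_eq_twisted_flip twisted_flip_def
        monomial_mat_def cyclic_weight_def mat_def scale_mat_def)
qed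

end
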